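(* Let $n,i,j$ be integers with $i$ odd, $0\le j<i-2$ and $i+2\le n$, and let $D^n_1$ be the $(n+1)\times(n+1)$ matrix defined in the context. Then $$(D^n_1)_{n-i+2,\,n-j}+k^1_{n,i,j}\,(D^n_1)_{n-i,\,n-j}+k^2_{n,i,j}\,(D^n_1)_{n-i-2,\,n-j}=0,$$ where $$k^1_{n,i,j}= h\left(\left(cd(a-b)-\frac{b(e-a)(f-a)(g-a)}{a-b-1}\right)\frac{1+a-b}{a(e-b)(f-b)(g-b)}-1\right),$$ $$k^2_{n,i,j}= l\,\frac{b(e-a)(f-a)(g-a)(1+a-b)}{(a-b-1)\,a(e-b)(f-b)(g-b)},$$ with $$a=\tfrac{j-i+1}{2},\quad b=-n+\tfrac{i+j}{2},\quad c=-\tfrac j2,\quad d=n+\tfrac{3-j}{2},\quad e=1,\quad f=\tfrac12,\quad g=\tfrac32,$$ $$h=\frac{\sqrt{2(n-i)+5}\,(-2n+i+j-1)}{\sqrt{2(n-i)+1}\,(i-j-2)},\qquad l=\frac{\sqrt{2(n-i)+5}\,(2n-i-j-1)(2n-i-j+1)}{\sqrt{2(n-i)-3}\,(i-j)(i-j-2)}.$$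
   Context: The matrix $D^n_1$ (rows and columns indexed $0,\dots,n$) has entries $(D^n_1)_{r,s}=2\int_0^1 h^n_r(t)\,\hat p_s(2t-1)\,dt$, where $\hat p_s$ is the Legendre polynomial of degree $s$ with positive leading coefficient, orthonormal on $[-1,1]$ ($\int_{-1}^1\hat p_r\hat p_s\,dt=\delta_{r,s}$), and the functions $h^n_r$ are defined as follows. Let $(x)_0=1$, $(x)_m=x(x+1)\cdots(x+m-1)$ for $m>0$; empty products equal $1$. For $n\ge0$, $0\le k\le n$, and $0\le p\le n$ with $p=0$ or $p$ odd, let $$d^p_{n,k}=(-1)^n\frac{\sqrt{2n-2p+1}}{(-n)_p}\frac{(-n)_k(n-p+1)_k}{(1)_k(1)_k}\prod_{m=0}^{\frac{p-1}{2}}(n+k+1-2m)\prod_{m=0}^{\frac{p-3}{2}}(n-k-1-2m).$$ For $0\le t<1$ let $h_{n-p}^n(t)=\sum_{k=0}^n d^p_{n,k}t^k$ if $p=0$ or $p$ is odd, and $h_{n-p}^n(t)=\sum_{k=0}^{n-1} d^{p-1}_{n-1,k}t^k$ if $p>0$ is even ($0\le p\le n$). *)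

theory Defs
  imports
    "HOL-Analysis.Analysis"
    "HOL-Computational_Algebra.Polynomial"
    "Jordan_Normal_Form.Matrix"
begin

definition legendre_family :: "(nat \<Rightarrow> real poly) \<Rightarrow> bool" where
  "legendre_family P \<longleftrightarrow>
     (\<forall>s. degree (P s) = s \<and> lead_coeff (P s) > 0) \<and>
     (\<forall>r s. integral {-1..1} (\<lambda>t. poly (P r) t * poly (P s) t) = (if r = s then 1 else 0))"

(* Well defined by legendre_family_ex1 below. *)
definition legendre_hat :: "nat \<Rightarrow> real poly" where
  "legendre_hat = (THE P. legendre_family P)"

(* Meant for p <= n with p = 0 or p odd. The two products run over
   m = 0, ..., (p-1)/2 and m = 0, ..., (p-3)/2 and are empty when the upper limit is negative
   (in particular for p = 0); for such p they have (p+1) div 2 and (p-1) div 2 factors. *)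
definition d_coeff :: "nat \<Rightarrow> nat \<Rightarrow> nat \<Rightarrow> real" where
  "d_coeff p n k =
     (-1) ^ n * (sqrt (2 * real n - 2 * real p + 1) / pochhammer (- real n) p)
     * ((pochhammer (- real n) k * pochhammer (real n - real p + 1) k)
        / (pochhammer 1 k * pochhammer 1 k))
     * (\<Prod>m<(p + 1) div 2. real n + real k + 1 - 2 * real m)
     * (\<Prod>m<(p - 1) div 2. real n - real k - 1 - 2 * real m)"

(* The superscript is n and the subscript is r = n - p, for r <= n. The functions are specified
   on [0,1) only; the polynomial formula is used here for every real t, as only the integral
   over the unit interval matters. *)
definition h_fun :: "nat \<Rightarrow> nat \<Rightarrow> real \<Rightarrow> real" where
  "h_fun n r t =
     (let p = n - r in
      if p = 0 \<or> odd p then \<Sum>k=0..n. d_coeff p n k * t ^ k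
      else \<Sum>k=0..n-1. d_coeff (p - 1) (n - 1) k * t ^ k)"

definition D1 :: "nat \<Rightarrow> real mat" where
  "D1 n = Matrix.mat (n + 1) (n + 1)
     (\<lambda>(r, s). 2 * integral {0..1} (\<lambda>t. h_fun n r t * poly (legendre_hat s) (2 * t - 1)))"

definition k1 :: "nat \<Rightarrow> nat \<Rightarrow> nat \<Rightarrow> real" where
  "k1 n i j =
     (let a = (real j - real i + 1) / 2;
          b = - real n + (real i + real j) / 2;
          c = - real j / 2;
          d = real n + (3 - real j) / 2;
          e = 1;
          f = 1 / 2;
          g = 3 / 2;
          h = (sqrt (2 * (real n - real i) + 5) * (- 2 * real n + real i + real j - 1))
              / (sqrt (2 * (real n - real i) + 1) * (real i - real j - 2))
      in h * ((c * d * (a - b) - (b * (e - a) * (f - a) * (g - a)) / (a - b - 1))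
              * ((1 + a - b) / (a * (e - b) * (f - b) * (g - b))) - 1))"

definition k2 :: "nat \<Rightarrow> nat \<Rightarrow> nat \<Rightarrow> real" where
  "k2 n i j =
     (let a = (real j - real i + 1) / 2;
          b = - real n + (real i + real j) / 2;
          e = 1;
          f = 1 / 2;
          g = 3 / 2;
          l = (sqrt (2 * (real n - real i) + 5)
                 * (2 * real n - real i - real j - 1) * (2 * real n - real i - real j + 1))
              / (sqrt (2 * (real n - real i) - 3) * (real i - real j) * (real i - real j - 2))
      in l * ((b * (e - a) * (f - a) * (g - a) * (1 + a - b))
              / ((a - b - 1) * a * (e - b) * (f - b) * (g - b))))"

definition poly_inner :: "real poly \<Rightarrow> real poly \<Rightarrow> real" where
  "poly_inner p q = integral {-1..1} (\<lambda>t. poly p t * poly q t)"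

lemma poly_inner_commute: "poly_inner p q = poly_inner q p"
  by (simp add: poly_inner_def mult.commute)

lemma poly_mult_integrable: "(\<lambda>t. poly p t * poly q t) integrable_on {-1..1::real}"
  by (intro integrable_continuous_real continuous_intros)

lemma poly_inner_add_left: "poly_inner (p + q) r = poly_inner p r + poly_inner q r"
  by (simp add: poly_inner_def algebra_simps
      integral_add[OF poly_mult_integrable poly_mult_integrable, symmetric])

lemma poly_inner_smult_left: "poly_inner (Polynomial.smult c p) r = c * poly_inner p r"
  by (simp add: poly_inner_def mult.assoc)

lemma poly_inner_zero_left [simp]: "poly_inner 0 r = 0"
  by (simp add: poly_inner_def)

lemma poly_inner_smult_right: "poly_inner r (Polynomial.smult c p) = c * poly_inner r p"
  by (metis poly_inner_commute poly_inner_smult_left)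

lemma poly_inner_diff_left: "poly_inner (p - q) r = poly_inner p r - poly_inner q r"
  using poly_inner_add_left[of "p - q" q r] by simp

lemma poly_inner_sum_left: "poly_inner (\<Sum>x\<in>A. p x) r = (\<Sum>x\<in>A. poly_inner (p x) r)"
  by (induction A rule: infinite_finite_induct) (auto simp: poly_inner_add_left)

lemma poly_inner_self_pos:
  assumes "p \<noteq> 0"
  shows "poly_inner p p > 0"
proof -
  have ge: "poly_inner p p \<ge> 0"
    unfolding poly_inner_def by (intro integral_nonneg poly_mult_integrable) simp
  have "poly_inner p p \<noteq> 0"
  proof
    assume z: "poly_inner p p = 0"
    have "((\<lambda>t. poly p t * poly p t) has_integral 0) (cbox (-1) (1::real))"
      using poly_mult_integrable[of p p] z unfolding poly_inner_def
      by (simp add: has_integral_integral)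
    then have "poly p t * poly p t = 0" if "t \<in> {-1..1}" for t
      using that
      by (intro has_integral_0_cbox_imp_0[of "-1" 1 "\<lambda>t. poly p t * poly p t"])
        (auto intro!: continuous_intros)
    then have "{-1..1} \<subseteq> {t. poly p t = 0}" by auto
    moreover have "infinite {-1..1::real}" by simp
    ultimately show False using poly_roots_finite[OF assms] finite_subset by blast
  qed
  with ge show ?thesis by simp
qed

fun gram_schmidt_monom :: "nat \<Rightarrow> real poly" where
  "gram_schmidt_monom s =
     (let q = monom 1 s
            - (\<Sum>k<s. Polynomial.smult (poly_inner (monom 1 s) (gram_schmidt_monom k)) (gram_schmidt_monom k))
      in Polynomial.smult (1 / sqrt (poly_inner q q)) q)"

declare gram_schmidt_monom.simps [simp del]

lemma gram_schmidt_monom_props: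
  "degree (gram_schmidt_monom s) = s \<and> lead_coeff (gram_schmidt_monom s) > 0
   \<and> poly_inner (gram_schmidt_monom s) (gram_schmidt_monom s) = 1
   \<and> (\<forall>k<s. poly_inner (gram_schmidt_monom s) (gram_schmidt_monom k) = 0)"
proof (induction s rule: less_induct)
  case (less s)
  let ?G = gram_schmidt_monom
  define S where "S = (\<Sum>k<s. Polynomial.smult (poly_inner (monom 1 s) (?G k)) (?G k))"
  define q where "q = monom 1 s - S"
  have G: "?G s = Polynomial.smult (1 / sqrt (poly_inner q q)) q"
    by (subst gram_schmidt_monom.simps) (simp add: q_def S_def Let_def)
  have S_coeff: "coeff S m = 0" if "m \<ge> s" for m
    using that less by (auto simp: S_def coeff_sum intro!: sum.neutral coeff_eq_0)
  have qs: "coeff q s = 1" by (simp add: q_def S_coeff)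
  have "degree q \<le> s" by (rule degree_le) (simp add: q_def S_coeff)
  with qs have deg: "degree q = s" by (metis le_antisym le_degree zero_neq_one)
  have "q \<noteq> 0" using qs by auto
  then have pos: "poly_inner q q > 0" by (rule poly_inner_self_pos)
  have orth: "poly_inner (?G m) (?G k) = (if m = k then 1 else 0)" if "m < s" "k < s" for m k
    using less[OF that(1)] less[OF that(2)] poly_inner_commute[of "?G m" "?G k"]
    by (cases m k rule: linorder_cases) auto
  have "poly_inner q (?G k) = 0" if "k < s" for k
    using that
    by (simp add: q_def S_def poly_inner_diff_left poly_inner_sum_left poly_inner_smult_left orth
        if_distrib sum.delta cong: if_cong)
  then show ?case
    using pos deg qs
    by (simp add: G poly_inner_smult_left poly_inner_smult_right)
qed

lemma legendre_family_gram_schmidt: "legendre_family gram_schmidt_monom"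
  unfolding legendre_family_def
proof (intro conjI allI)
  fix r s
  show "integral {-1..1} (\<lambda>t. poly (gram_schmidt_monom r) t * poly (gram_schmidt_monom s) t)
        = (if r = s then 1 else 0)"
    using gram_schmidt_monom_props[of r] gram_schmidt_monom_props[of s]
      poly_inner_commute[of "gram_schmidt_monom r" "gram_schmidt_monom s"]
    by (fold poly_inner_def, cases r s rule: linorder_cases) auto
qed (use gram_schmidt_monom_props in blast)+

lemma legendre_family_orthogonal_lower:
  assumes P: "legendre_family P" and q: "q = 0 \<or> degree q < s"
  shows "poly_inner q (P s) = 0"
  using q
proof (induction "degree q" arbitrary: q rule: less_induct)
  case less
  show ?case
  proof (cases "q = 0")
    case False
    define m where "m = degree q"
    define c where "c = lead_coeff q / lead_coeff (P m)"
    have Pm: "degree (P m) = m" "lead_coeff (P m) > 0"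
      using P unfolding legendre_family_def by metis+
    define r where "r = q - Polynomial.smult c (P m)"
    have "m < s" using less.prems False m_def by simp
    have "poly_inner (P m) (P s) = 0"
      using P \<open>m < s\<close> by (simp add: legendre_family_def poly_inner_def)
    moreover have "poly_inner r (P s) = 0"
    proof (cases "r = 0")
      case False
      have "coeff r m = 0" using Pm by (simp add: r_def c_def m_def)
      moreover have "degree r \<le> m" using Pm
        by (simp add: r_def m_def degree_diff_le)
      ultimately have "degree r < m"
        using False by (metis eq_zero_or_degree_less)
      then show ?thesis using less.hyps[of r] \<open>m < s\<close> m_def by simp
    qed simp
    ultimately show ?thesis
      by (simp add: r_def poly_inner_diff_left poly_inner_smult_left)
  qed simp
qed

lemma legendre_family_unique:
  assumes P: "legendre_family P" and Q: "legendre_family Q"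
  shows "P = Q"
proof
  fix s
  have Ps: "degree (P s) = s" "lead_coeff (P s) > 0" "poly_inner (P s) (P s) = 1"
    and Qs: "degree (Q s) = s" "lead_coeff (Q s) > 0" "poly_inner (Q s) (Q s) = 1"
    using P Q unfolding legendre_family_def poly_inner_def by metis+
  define c where "c = lead_coeff (Q s) / lead_coeff (P s)"
  define r where "r = Q s - Polynomial.smult c (P s)"
  have c: "c > 0" using Ps Qs by (simp add: c_def)
  have "coeff r s = 0" using Ps Qs by (simp add: r_def c_def)
  moreover have "degree r \<le> s" using Ps Qs
    by (simp add: r_def degree_diff_le)
  ultimately have *: "r = 0 \<or> degree r < s" by (metis eq_zero_or_degree_less)
  have "poly_inner r r = poly_inner (Q s) r - c * poly_inner (P s) r"
    by (subst r_def) (simp add: poly_inner_diff_left poly_inner_smult_left)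
  also have "\<dots> = 0"
    using legendre_family_orthogonal_lower[OF P *] legendre_family_orthogonal_lower[OF Q *]
    by (simp add: poly_inner_commute)
  finally have "r = 0" using poly_inner_self_pos[of r] by fastforce
  then have "Q s = Polynomial.smult c (P s)" by (simp add: r_def)
  then have "c * c = 1" using Ps Qs by (simp add: poly_inner_smult_left poly_inner_smult_right)
  with c have "c = 1" by (auto simp: square_eq_1_iff)
  with \<open>Q s = _\<close> show "P s = Q s" by simp
qed

lemma legendre_family_ex1: "\<exists>!P. legendre_family P"
  using legendre_family_gram_schmidt legendre_family_unique by blast

lemma legendre_family_legendre_hat: "legendre_family legendre_hat"
  unfolding legendre_hat_def by (rule theI'[OF legendre_family_ex1])

end

theory Submission
  imports Defs
begin

text \<open>
Why the recurrence holds. Up to a factor depending only on the column \<open>s\<close>, the \<open>k\<close>-th moment on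
\<open>[0,1]\<close> of the shifted Legendre polynomial of degree \<open>s\<close> is an explicit quotient of products
(\<open>legendre_moments\<close>), and that factor is common to the three entries. An entry in row \<open>n - p\<close> and
column \<open>n - j\<close>, with \<open>p\<close> odd and \<open>j < p\<close>, is therefore a multiple of
\<open>\<Sum>k\<le>n. d_coeff p n k * moment_ratio (n - j) k\<close>, with the same multiplier for all \<open>p\<close>. The moments vanish for \<open>k < n - j\<close>, and the last
product in \<open>d_coeff\<close> vanishes for odd \<open>n - k < p\<close>, so only \<open>k = n - 2m\<close> with \<open>2m \<le> j\<close> survive
(\<open>sum_even_offsets\<close>). What remains is a terminating hypergeometric sum in \<open>m\<close>.

Replacing \<open>p\<close> by \<open>p + 2\<close> multiplies the summand by a simple rational function of \<open>m\<close>
(\<open>d_coeff_shift_order\<close>). With \<open>p = i - 2\<close>, the combination of the three rows is thus a single sum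
of terms \<open>w m * B m\<close>, where \<open>w\<close> is the summand for \<open>p\<close> and \<open>B\<close> is rational. As in Zeilberger's
creative telescoping, each such term is a difference \<open>U m - L m\<close> with \<open>U m = L (m + 1)\<close>:
divided by \<open>w m\<close> this is the identity \<open>certificate\<close> between rational functions, and
\<open>U m = L (m + 1)\<close> is the ratio of consecutive summands (\<open>summand_shift\<close>). Since \<open>L 0 = 0\<close>, the sum
equals the last \<open>U\<close>, which contains the factor \<open>(j - 2m) (j - 2m - 1)\<close> and so vanishes at
\<open>m = j div 2\<close>.

Throughout the telescoping part the parameters are \<open>X = 2n - i - j\<close>, \<open>Y = i - j\<close>, \<open>J = j\<close> and
\<open>A = j - 2m\<close>, in which all factors have small integer offsets.
\<close>

section \<open>Moments of the Legendre polynomials on the unit interval\<close>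

text \<open>
The numerator vanishes for \<open>k < s\<close>; for \<open>k \<ge> s\<close> the value is
\<open>(k!)\<^sup>2 / ((k - s)! (k + s + 1)!)\<close>.
\<close>
definition moment_ratio :: "nat \<Rightarrow> nat \<Rightarrow> real" where
  "moment_ratio s k = (\<Prod>l<s. real k - real l) / (\<Prod>l<Suc s. real k + real l + 1)"

lemma has_integral_power_unit: "((\<lambda>t. t ^ m) has_integral 1 / (real m + 1)) {0..1::real}"
proof -
  have "((\<lambda>t::real. t ^ Suc m / (real m + 1)) has_vector_derivative t ^ m) (at t within {0..1})" for t
    using DERIV_cdivide[OF DERIV_pow[of "Suc m" t], of "real m + 1"]
    by (simp add: has_real_derivative_iff_has_vector_derivative add.commute)
  from fundamental_theorem_of_calculus[of 0 1, OF _ this] show ?thesis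
    by simp
qed

lemma monomial_moment_poly:
  assumes "degree Q \<le> s"
  shows "((\<lambda>t. t ^ k * poly Q t) has_integral (\<Sum>l\<le>s. coeff Q l / (real k + real l + 1))) {0..1::real}"
proof -
  have "poly Q t = (\<Sum>l\<le>s. coeff Q l * t ^ l)" for t
    by (subst poly_as_sum_of_monoms'[OF assms, symmetric]) (simp add: poly_sum poly_monom)
  then have "t ^ k * poly Q t = (\<Sum>l\<le>s. coeff Q l * t ^ (k + l))" for t
    by (simp add: sum_distrib_left power_add mult_ac)
  moreover have "((\<lambda>t. coeff Q l * t ^ (k + l)) has_integral coeff Q l / (real k + real l + 1)) {0..1::real}" for l
    using has_integral_mult_right[OF has_integral_power_unit[of "k + l"], of "coeff Q l"] by (simp add: add_ac)
  ultimately show ?thesis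
    by (simp only:) (intro has_integral_sum; simp)
qed

text \<open>
Over the common denominator \<open>\<Prod>l\<le>s. (k + l + 1)\<close> the moment becomes a polynomial in \<open>k\<close> of degree at
most \<open>s\<close>. Orthogonality gives its \<open>s\<close> roots \<open>0, \<dots>, s - 1\<close>, which determine it up to a
constant.
\<close>
lemma moments_of_orthogonal_poly:
  fixes Q :: "real poly"
  assumes deg: "degree Q \<le> s"
    and orth: "\<And>k. k < s \<Longrightarrow> integral {0..1} (\<lambda>t. t ^ k * poly Q t) = 0"
  obtains c where "\<And>k. integral {0..1} (\<lambda>t. t ^ k * poly Q t) = c * moment_ratio s k"
proof -
  define N where "N = (\<Sum>l\<le>s. Polynomial.smult (coeff Q l) (\<Prod>u\<in>{..s} - {l}. [:real u + 1, 1:]))"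
  define R :: "real poly" where "R = (\<Prod>l<s. [:- real l, 1:])"
  define D where "D k = (\<Prod>l<Suc s. real k + real l + 1)" for k
  have D0: "D k \<noteq> 0" for k
    by (auto simp: D_def prod_zero_iff)
  have N: "poly N (real k) = integral {0..1} (\<lambda>t. t ^ k * poly Q t) * D k" for k
  proof -
    have "D k = (real k + real l + 1) * (\<Prod>u\<in>{..s} - {l}. real k + real u + 1)" if "l \<le> s" for l
      using that unfolding D_def by (subst prod.remove[of _ l]) (auto simp: lessThan_Suc_atMost)
    then have "coeff Q l / (real k + real l + 1) * D k = coeff Q l * (\<Prod>u\<in>{..s} - {l}. real k + real u + 1)"
      if "l \<le> s" for l
      using that by simp
    then show ?thesis
      using integral_unique[OF monomial_moment_poly[OF deg, of k]]
      by (simp add: N_def poly_sum poly_prod sum_distrib_right add_ac)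
  qed
  have "degree (\<Prod>u\<in>{..s} - {l}. [:real u + 1, 1:]) \<le> s" if "l \<le> s" for l
  proof -
    have "degree (\<Prod>u\<in>{..s} - {l}. [:real u + 1, 1:]) = (\<Sum>u\<in>{..s} - {l}. degree [:real u + 1, 1:])"
      by (rule degree_prod_sum_eq) simp
    then show ?thesis using that by simp
  qed
  then have degN: "degree N \<le> s"
    unfolding N_def by (intro degree_sum_le) (auto intro: order.trans[OF degree_smult_le])
  have degR: "degree R = s"
    unfolding R_def by (subst degree_prod_sum_eq) auto
  have "lead_coeff R = 1"
    unfolding R_def by (subst lead_coeff_prod) auto
  then have leadR: "coeff R s = 1" using degR by simp
  have "N = Polynomial.smult (coeff N s) R"
  proof (rule poly_eqI_degree_lead_coeff[where n = s and A = "real ` {..<s}"])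
    show "s \<le> card (real ` {..<s})" by (simp add: card_image)
    show "poly N z = poly (Polynomial.smult (coeff N s) R) z" if "z \<in> real ` {..<s}" for z
      using that N orth by (auto simp: R_def poly_prod prod_zero_iff)
  qed (use degN degR leadR in auto)
  then have R: "poly N (real k) = coeff N s * (\<Prod>l<s. real k - real l)" for k
    by (metis (no_types, lifting) R_def poly_prod poly_smult poly_pCons poly_0 mult_zero_right add_0_right
        mult.right_neutral prod.cong diff_conv_add_uminus add.commute)
  have "integral {0..1} (\<lambda>t. t ^ k * poly Q t) = coeff N s * moment_ratio s k" for k
  proof -
    have "moment_ratio s k = (\<Prod>l<s. real k - real l) / D k"
      by (simp add: moment_ratio_def D_def)
    then show ?thesis
      using N[of k] D0[of k] R[of k] by (metis nonzero_eq_divide_eq times_divide_eq_right)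
  qed
  then show thesis by (rule that)
qed

lemma legendre_moments:
  obtains c where "\<And>k. integral {0..1} (\<lambda>t. t ^ k * poly (legendre_hat s) (2 * t - 1)) = c * moment_ratio s k"
proof -
  define Q where "Q = pcompose (legendre_hat s) [:- 1, 2:]"
  have deg: "degree (legendre_hat s) = s"
    using legendre_family_legendre_hat by (simp add: legendre_family_def)
  have "integral {0..1} (\<lambda>t. t ^ k * poly Q t) = 0" if "k < s" for k
  proof -
    (* t^k, written in the variable x = 2 t - 1 *)
    define f where "f x = poly ([:1/2, 1/2:] ^ k) x * poly (legendre_hat s) x" for x
    have "degree ([:1/2, 1/2::real:] ^ k) < s"
      using that by (simp add: degree_power_eq)
    then have "(f has_integral 0) (cbox (- 1) 1)"
      using legendre_family_orthogonal_lower[OF legendre_family_legendre_hat, of "[:1/2, 1/2:] ^ k" s]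
        integrable_integral[OF poly_mult_integrable[of "[:1/2, 1/2:] ^ k" "legendre_hat s"]]
      by (simp add: poly_inner_def f_def[abs_def])
    from has_integral_affinity'[OF this, of 2 "- 1"]
    have "((\<lambda>t. f (2 * t - 1)) has_integral 0) {0..1}"
      by simp
    moreover have "f (2 * t - 1) = t ^ k * poly Q t" for t
      by (simp add: f_def Q_def poly_pcompose algebra_simps diff_divide_distrib)
    ultimately show ?thesis by (simp add: integral_unique)
  qed
  moreover have "degree Q \<le> s"
    using degree_pcompose_le[of "legendre_hat s" "[:- 1, 2:]"] by (simp add: Q_def deg)
  ultimately obtain c where "\<And>k. integral {0..1} (\<lambda>t. t ^ k * poly Q t) = c * moment_ratio s k"
    using moments_of_orthogonal_poly by blast
  moreover have "poly Q t = poly (legendre_hat s) (2 * t - 1)" for t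
    by (simp add: Q_def poly_pcompose algebra_simps)
  ultimately show thesis
    by (intro that[of c]) simp
qed

lemma D1_entry:
  obtains c where "\<And>n p. \<lbrakk>odd p; p \<le> n; s \<le> n\<rbrakk> \<Longrightarrow>
    D1 n $$ (n - p, s) = c * (\<Sum>k\<le>n. d_coeff p n k * moment_ratio s k)"
proof -
  obtain c where c: "\<And>k. integral {0..1} (\<lambda>t. t ^ k * poly (legendre_hat s) (2 * t - 1)) = c * moment_ratio s k"
    using legendre_moments by blast
  have "D1 n $$ (n - p, s) = 2 * c * (\<Sum>k\<le>n. d_coeff p n k * moment_ratio s k)"
    if "odd p" "p \<le> n" "s \<le> n" for n p
  proof -
    let ?L = "\<lambda>t. poly (legendre_hat s) (2 * t - 1)"
    have "h_fun n (n - p) t * ?L t = (\<Sum>k\<le>n. d_coeff p n k * (t ^ k * ?L t))" for t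
      using that by (simp add: h_fun_def sum_distrib_right atMost_atLeast0 mult.assoc)
    moreover have "(\<lambda>t. t ^ k * ?L t) integrable_on {0..1}" for k
      by (intro integrable_continuous_real continuous_intros)
    ultimately have "integral {0..1} (\<lambda>t. h_fun n (n - p) t * ?L t)
      = (\<Sum>k\<le>n. d_coeff p n k * (c * moment_ratio s k))"
      by (simp add: integral_sum integrable_on_mult_right c)
    then show ?thesis
      using that by (simp add: D1_def sum_distrib_left mult_ac)
  qed
  then show thesis by (rule that)
qed

section \<open>Ratios of consecutive summands\<close>

lemma moment_ratio_eq_0: "k < s \<Longrightarrow> moment_ratio s k = 0"
  by (auto simp: moment_ratio_def prod_zero_iff)

lemma prod_shift: "(\<Prod>u<q. f (Suc u)) * f 0 = (\<Prod>u<q. f u) * (f q :: real)"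
  using prod.lessThan_Suc_shift[of f q] by (simp add: mult.commute)

lemma moment_ratio_Suc:
  "moment_ratio s (Suc k) * ((real k + 1 - real s) * (real k + real s + 2)) = moment_ratio s k * (real k + 1) ^ 2"
proof -
  have 1: "(\<Prod>l<s. real k - real l) * (real k + 1) = (\<Prod>l<s. real (Suc k) - real l) * (real k + 1 - real s)"
    using prod_shift[of "\<lambda>u. real k + 1 - real u" s] by (simp add: algebra_simps)
  have 2: "(\<Prod>l<Suc s. real (Suc k) + real l + 1) * (real k + 1)
    = (\<Prod>l<Suc s. real k + real l + 1) * (real k + real s + 2)"
    using prod_shift[of "\<lambda>u. real k + real u + 1" "Suc s"] by (simp add: algebra_simps)
  have 3: "(\<Prod>l<Suc s. real k + real l + 1) \<noteq> 0" "(\<Prod>l<Suc s. real (Suc k) + real l + 1) \<noteq> 0"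
    by (auto simp: prod_zero_iff)
  have cross: "x / y * (a * b) = x' / y' * e ^ 2"
    if "x' * e = x * a" "y * e = y' * b" "y \<noteq> 0" "y' \<noteq> 0" for x y x' y' a b e :: real
  proof -
    have "x * a * (y' * b) = x' * e * (y * e)" using that by simp
    then show ?thesis using that(3,4) by (simp add: divide_simps power2_eq_square mult_ac)
  qed
  show ?thesis
    unfolding moment_ratio_def by (rule cross[OF 1 2 3(2,1)])
qed

text \<open>
The factor of the last product with \<open>2m = n - k - 1\<close> is zero; the bound on \<open>n - k\<close> makes this \<open>m\<close>
one of its indices.
\<close>
lemma d_coeff_eq_0:
  assumes "odd p" "odd (n - k)" "n - k < p"
  shows "d_coeff p n k = 0"
proof -
  obtain u where u: "n - k = 2 * u + 1" using assms(2) by (elim oddE)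
  then have "real n - real k - 1 - 2 * real u = 0" by linarith
  moreover have "u < (p - 1) div 2" using assms u by presburger
  ultimately show ?thesis
    unfolding d_coeff_def by (auto simp: prod_zero_iff)
qed

text \<open>
Both products gain one factor, and the gained \<open>n + k - p\<close> cancels against one of the two factors by
which the Pochhammer symbols change.
\<close>
lemma d_coeff_shift_order:
  assumes "odd p" "p + 2 \<le> n" "p + 1 < n + k"
  shows "d_coeff (p + 2) n k = sqrt (2 * (real n - real p) - 3) / sqrt (2 * (real n - real p) + 1)
    * ((real n - real k - real p) / (real n + real k - real p - 1)) * d_coeff p n k"
proof -
  obtain q where q: "p = 2 * q + 1" using assms(1) by (elim oddE)
  have poch_n: "pochhammer (- real n) (p + 2) = pochhammer (- real n) p * ((real p - real n) * (real p + 1 - real n))"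
    by (simp add: pochhammer_Suc algebra_simps)
  have poch_k: "pochhammer (real n - real (p + 2) + 1) k * ((real n + real k - real p - 1) * (real n + real k - real p))
    = (real n - real p - 1) * (real n - real p) * pochhammer (real n - real p + 1) k"
    using pochhammer_product'[of "real n - real p - 1" 2 k] pochhammer_product'[of "real n - real p - 1" k 2]
    by (simp add: numeral_2_eq_2 pochhammer_Suc algebra_simps)
  have nz: "pochhammer (- real n) p \<noteq> 0"
    using assms by (subst pochhammer_eq_0_iff) auto
  have nz': "real n - real p > 0" "real n - real p - 1 > 0" "real n + real k - real p - 1 > 0"
    "real n + real k - real p > 0"
    using assms by linarith+
  have A: "pochhammer (real n - real (p + 2) + 1) k / pochhammer (- real n) (p + 2)
     = pochhammer (real n - real p + 1) k / pochhammer (- real n) p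
       / ((real n + real k - real p - 1) * (real n + real k - real p))"
  proof -
    have quot: "x' / (y * (u * v)) = x / y / (a * b)"
      if "x' * (a * b) = (- v) * (- u) * x" "y \<noteq> 0" "u \<noteq> 0" "v \<noteq> 0" "a \<noteq> 0" "b \<noteq> 0"
      for x x' y u v a b :: real
      using that by (simp add: divide_simps mult_ac)
    have "- (real p + 1 - real n) * - (real p - real n) = (real n - real p - 1) * (real n - real p)"
      by (simp add: algebra_simps)
    with poch_k nz nz' show ?thesis
      unfolding poch_n by (intro quot) auto
  qed
  have prods: "(\<Prod>m<(p + 2 + 1) div 2. real n + real k + 1 - 2 * real m)
      = (\<Prod>m<(p + 1) div 2. real n + real k + 1 - 2 * real m) * (real n + real k - real p)"
    "(\<Prod>m<(p + 2 - 1) div 2. real n - real k - 1 - 2 * real m)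
      = (\<Prod>m<(p - 1) div 2. real n - real k - 1 - 2 * real m) * (real n - real k - real p)"
    by (simp_all add: q)
  have root: "2 * real n - 2 * real (p + 2) + 1 = 2 * (real n - real p) - 3" by simp
  have new: "d_coeff (p + 2) n k = sqrt (2 * (real n - real p) - 3)
     * ((-1) ^ n * (pochhammer (- real n) k / (pochhammer 1 k * pochhammer 1 k)))
     * (pochhammer (real n - real (p + 2) + 1) k / pochhammer (- real n) (p + 2))
     * (\<Prod>m<(p + 1) div 2. real n + real k + 1 - 2 * real m)
     * (\<Prod>m<(p - 1) div 2. real n - real k - 1 - 2 * real m) * (real n + real k - real p) * (real n - real k - real p)"
    unfolding d_coeff_def prods root by (simp only: times_divide_eq_left times_divide_eq_right divide_divide_eq_left mult_ac)
  have old: "d_coeff p n k = sqrt (2 * (real n - real p) + 1)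
     * ((-1) ^ n * (pochhammer (- real n) k / (pochhammer 1 k * pochhammer 1 k)))
     * (pochhammer (real n - real p + 1) k / pochhammer (- real n) p)
     * (\<Prod>m<(p + 1) div 2. real n + real k + 1 - 2 * real m)
     * (\<Prod>m<(p - 1) div 2. real n - real k - 1 - 2 * real m)"
    by (simp add: d_coeff_def algebra_simps)
  have quot: "s' * S * (B / (e * f)) * P * R * f * g = s' / s * (g / e) * (s * S * B * P * R)"
    if "f \<noteq> 0" "s \<noteq> 0" for s s' S B P R e f g :: real
    using that by simp
  show ?thesis
    unfolding new old A by (rule quot) (use nz' in auto)
qed

text \<open>
When \<open>k\<close> grows by 2, the last product loses its first factor \<open>n - k - 1\<close> and gains \<open>n - k - p\<close>.
The lost factor is supplied again by \<open>pochhammer (- n) k\<close>, which grows by \<open>(n - k) (n - k - 1)\<close>; the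
first product and \<open>pochhammer (n - p + 1) k\<close> share \<open>n + k + 2 - p\<close> in the same way.
\<close>
lemma d_coeff_shift_degree:
  assumes "odd p"
  shows "d_coeff p n (k + 2) * ((real k + 1)\<^sup>2 * (real k + 2)\<^sup>2)
    = d_coeff p n k * ((real n - real k) * (real n + real k + 1 - real p) * (real n + real k + 3) * (real n - real k - real p))"
proof -
  obtain q where q: "p = 2 * q + 1" using assms(1) by (elim oddE)
  have p1: "pochhammer (- real n) (k + 2) = pochhammer (- real n) k * ((real n - real k) * (real n - real k - 1))"
    and p2: "pochhammer (real n - real p + 1) (k + 2)
      = pochhammer (real n - real p + 1) k * ((real n + real k + 1 - real p) * (real n + real k + 2 - real p))"
    and p3: "pochhammer (1::real) (k + 2) = pochhammer 1 k * ((real k + 1) * (real k + 2))"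
    by (simp_all add: pochhammer_Suc algebra_simps)
  have q1: "(\<Prod>m<(p + 1) div 2. real n + real (k + 2) + 1 - 2 * real m) * (real n + real k + 2 - real p)
    = (\<Prod>m<(p + 1) div 2. real n + real k + 1 - 2 * real m) * (real n + real k + 3)"
    using prod_shift[of "\<lambda>m. real n + real k + 3 - 2 * real m" "q + 1"] by (simp add: q algebra_simps)
  have q2: "(\<Prod>m<(p - 1) div 2. real n - real (k + 2) - 1 - 2 * real m) * (real n - real k - 1)
    = (\<Prod>m<(p - 1) div 2. real n - real k - 1 - 2 * real m) * (real n - real k - real p)"
    using prod_shift[of "\<lambda>m. real n - real k - 1 - 2 * real m" q] by (simp add: q algebra_simps)
  have k: "pochhammer (1::real) k \<noteq> 0" by (simp add: pochhammer_fact[symmetric])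
  have alg: "S * (A * (x * y) * (B * (z * w)) / ((C * (a * b)) * (C * (a * b)))) * P' * Q' * (a\<^sup>2 * b\<^sup>2)
     = S * (A * B / (C * C)) * P * Q * (x * z * t * v)"
    if "P' * w = P * t" "Q' * y = Q * v" "C \<noteq> 0" "a \<noteq> 0" "b \<noteq> 0"
    for S A B C x y z w a b P P' Q Q' t v :: real
  proof -
    have "S * (A * (x * y) * (B * (z * w)) / ((C * (a * b)) * (C * (a * b)))) * P' * Q' * (a\<^sup>2 * b\<^sup>2)
      = S * A * B * x * z / (C * C) * (P' * w) * (Q' * y)"
      using that(3-5) by (simp add: divide_simps power2_eq_square)
    then show ?thesis using that(1,2) by simp
  qed
  show ?thesis
    unfolding d_coeff_def p1 p2 p3
    by (rule alg[OF q1 q2 k]) auto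
qed

lemma summand_shift:
  assumes "odd p"
  shows "d_coeff p n (k + 2) * moment_ratio s (k + 2)
      * ((real k + 1 - real s) * (real k + real s + 2) * (real k + 2 - real s) * (real k + real s + 3))
    = d_coeff p n k * moment_ratio s k
      * ((real n - real k) * (real n + real k + 1 - real p) * (real n + real k + 3) * (real n - real k - real p))"
proof -
  have m1: "moment_ratio s (k + 1) * ((real k + 1 - real s) * (real k + real s + 2)) = moment_ratio s k * (real k + 1)\<^sup>2"
    using moment_ratio_Suc[of s k] by simp
  have m2: "moment_ratio s (k + 2) * ((real k + 2 - real s) * (real k + real s + 3)) = moment_ratio s (k + 1) * (real k + 2)\<^sup>2"
    using moment_ratio_Suc[of s "k + 1"] by (simp add: algebra_simps)
  have "d' * m'' * (a * b * a' * b') = d * m * e"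
    if "m' * (a * b) = m * x" "m'' * (a' * b') = m' * y" "d' * (x * y) = d * e"
    for a b a' b' d d' e m m' m'' x y :: real
  proof -
    have "d' * m'' * (a * b * a' * b') = d' * (m'' * (a' * b')) * (a * b)" by simp
    also have "\<dots> = d' * y * (m' * (a * b))" unfolding that(2) by simp
    also have "\<dots> = d' * (x * y) * m" unfolding that(1) by simp
    also have "\<dots> = d * m * e" unfolding that(3) by simp
    finally show ?thesis .
  qed
  from this[OF m1 m2 d_coeff_shift_degree[OF assms(1)]] show ?thesis .
qed

section \<open>Creative telescoping\<close>

lemma sum_even_offsets:
  assumes "odd p" "j < p" "p \<le> n"
  shows "(\<Sum>k\<le>n. d_coeff p n k * moment_ratio (n - j) k)
    = (\<Sum>m\<le>j div 2. d_coeff p n (n - 2 * m) * moment_ratio (n - j) (n - 2 * m))"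
proof -
  let ?w = "\<lambda>k. d_coeff p n k * moment_ratio (n - j) k"
  have inj: "inj_on (\<lambda>m. n - 2 * m) {..j div 2}"
    using assms by (intro inj_onI) auto
  have "?w k = 0" if k: "k \<in> {..n} - (\<lambda>m. n - 2 * m) ` {..j div 2}" for k
  proof (cases "k < n - j")
    case True
    then show ?thesis by (simp add: moment_ratio_eq_0)
  next
    case False
    have "odd (n - k)"
    proof
      assume "even (n - k)"
      then obtain m where m: "n - k = 2 * m" by (elim evenE)
      then have "k = n - 2 * m" "m \<le> j div 2" using k False by auto
      then show False using k by blast
    qed
    then show ?thesis
      using d_coeff_eq_0[OF assms(1)] False assms by auto
  qed
  then have "(\<Sum>k\<le>n. ?w k) = (\<Sum>k\<in>(\<lambda>m. n - 2 * m) ` {..j div 2}. ?w k)"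
    by (intro sum.mono_neutral_right) auto
  also have "\<dots> = (\<Sum>m\<le>j div 2. ?w (n - 2 * m))"
    using inj by (simp add: sum.reindex)
  finally show ?thesis .
qed

text \<open>
\<open>k1_rat\<close> and \<open>k2_rat\<close> are the coefficients of the recurrence without the quotients of square roots,
which cancel against those in \<open>d_coeff\<close>.
\<close>
definition k1_rat :: "real \<Rightarrow> real \<Rightarrow> real \<Rightarrow> real" where
  "k1_rat X Y J = (X + 1) / (Y - 2)
     + (X * Y * (Y + 1) * (Y + 2) / (X - Y - 1) - J * (X + Y + J + 3) * (X - Y + 1)) * (X - Y + 3)
       / ((Y - 2) * (Y - 1) * (X + 2) * (X + 3))"

definition k2_rat :: "real \<Rightarrow> real \<Rightarrow> real" where
  "k2_rat X Y = (X - 1) * X * (Y + 1) * (Y + 2) * (X - Y + 3)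
     / ((Y - 2) * (Y - 1) * (X + 2) * (X + 3) * (X - Y - 1))"

text \<open>
The constant of the certificate is forced: at \<open>A = 2 - Y\<close>, that is \<open>2m = i - 2\<close>, the left side of
the identity in \<open>certificate\<close> is 1 and the subtracted term on the right is 0.
\<close>
definition cert_const :: "real \<Rightarrow> real \<Rightarrow> real" where
  "cert_const X Y = (X - Y + 3) * (X - Y + 1) / ((X + 3) * (X + 2) * (Y - 2) * (Y - 1))"

text \<open>
The left side is the factor \<open>B m\<close> of the combined summand: \<open>(2 - Y - A) / (X + A + 1)\<close> and
\<open>(- Y - A) / (X + A - 1)\<close> are, apart from square roots, the ratios of the summands for \<open>p = i\<close> and
\<open>p = i - 2\<close> and for \<open>p = i + 2\<close> and \<open>p = i\<close>. The right side splits it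
into an upper and a lower boundary term. After clearing denominators this is a polynomial identity.
\<close>
lemma certificate:
  fixes X Y J A :: real
  assumes "Y - 1 \<noteq> 0" "Y - 2 \<noteq> 0" "X + 2 \<noteq> 0" "X + 3 \<noteq> 0" "X - Y - 1 \<noteq> 0"
    "X + A + 1 \<noteq> 0" "X + A - 1 \<noteq> 0"
  shows "1 + k1_rat X Y J * ((2 - Y - A) / (X + A + 1))
      + k2_rat X Y * ((2 - Y - A) / (X + A + 1) * ((- Y - A) / (X + A - 1)))
    = cert_const X Y * ((X + Y + A + 1) * (X + Y + A) * A * (A - 1)) / ((X + A + 1) * (X + A - 1))
      - cert_const X Y * ((J - A) * (X + Y + J + A + 3) * (2 - Y - A)) / (X + A + 1)"
proof -
  define Z where "Z = X - Y"
  have Z: "Z - 1 \<noteq> 0" using assms by (simp add: Z_def)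
  define E where "E = (Z - 1) * (Y - 2) * (Y - 1) * (X + 2) * (X + 3)"
  have E0: "E \<noteq> 0" using assms Z by (simp add: E_def)
  define k where "k = (Z + 3) * (Z + 1) * (Z - 1)"
  define u where "u = (X + 1) * ((Z - 1) * (Y - 1) * (X + 2) * (X + 3))
    + (X * Y * (Y + 1) * (Y + 2) - J * (X + Y + J + 3) * (Z + 1) * (Z - 1)) * (Z + 3)"
  define v where "v = (X - 1) * X * (Y + 1) * (Y + 2) * (Z + 3)"
  have over_E: "k1_rat X Y J = u / E" "k2_rat X Y = v / E" "cert_const X Y = k / E"
    using assms Z unfolding k1_rat_def k2_rat_def cert_const_def u_def v_def k_def E_def Z_def[symmetric]
    by (auto simp: divide_simps)+
  have main: "E * ((X + A + 1) * (X + A - 1)) + u * (2 - Y - A) * (X + A - 1) + v * ((2 - Y - A) * (- Y - A))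
     = k * ((X + Y + A + 1) * (X + Y + A) * A * (A - 1)) - k * ((J - A) * (X + Y + J + A + 3) * (2 - Y - A)) * (X + A - 1)"
    unfolding E_def u_def v_def k_def Z_def by Groebner_Basis.algebra
  have clear: "1 + u / E * (a / P) + v / E * (a / P * (b / Q)) = k / E * q / (P * Q) - k / E * r / P"
    if "E * (P * Q) + u * a * Q + v * (a * b) = k * q - k * r * Q" "P \<noteq> 0" "Q \<noteq> 0"
    for a b P Q q r
  proof -
    have "1 + u / E * (a / P) + v / E * (a / P * (b / Q)) = (E * (P * Q) + u * a * Q + v * (a * b)) / (E * P * Q)"
      using E0 that(2,3) by (simp add: add_divide_distrib mult_ac)
    also have "\<dots> = k / E * q / (P * Q) - k / E * r / P"
      unfolding that(1) using E0 that(2,3) by (simp add: diff_divide_distrib mult_ac)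
    finally show ?thesis .
  qed
  show ?thesis
    unfolding over_E by (rule clear[OF main assms(6,7)])
qed

text \<open>
The right side is the upper boundary term at \<open>N\<close>. It equals the lower boundary term at \<open>N + 1\<close>, which
is the induction step; the factor \<open>j - A 0 = 0\<close> of the lower boundary term starts the induction.
\<close>
lemma telescoping_partial_sum:
  assumes "odd p" "j < p" "p + 4 \<le> n" "N \<le> j div 2"
  defines "X \<equiv> 2 * real n - real p - 2 - real j" and "Y \<equiv> real p + 2 - real j"
  defines "A \<equiv> \<lambda>m. real j - 2 * real m"
  defines "w \<equiv> \<lambda>m. d_coeff p n (n - 2 * m) * moment_ratio (n - j) (n - 2 * m)"
  shows "(\<Sum>m\<le>N. w m * (1 + k1_rat X Y (real j) * ((2 - Y - A m) / (X + A m + 1))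
        + k2_rat X Y * ((2 - Y - A m) / (X + A m + 1) * ((- Y - A m) / (X + A m - 1)))))
    = w N * (cert_const X Y * ((X + Y + A N + 1) * (X + Y + A N) * A N * (A N - 1)) / ((X + A N + 1) * (X + A N - 1)))"
  using assms(4)
proof (induction N)
  case 0
  have "real j + 1 \<le> real p" "real p + 4 \<le> real n" using assms by linarith+
  then have nz: "Y - 1 \<noteq> 0" "Y - 2 \<noteq> 0" "X + 2 \<noteq> 0" "X + 3 \<noteq> 0" "X - Y - 1 \<noteq> 0" "X + A 0 + 1 \<noteq> 0" "X + A 0 - 1 \<noteq> 0"
    unfolding X_def Y_def A_def by linarith+
  show ?case
    using certificate[OF nz, of "real j"] by (simp add: A_def)
next
  case (Suc N)
  have N2: "2 * Suc N \<le> j" using Suc.prems by auto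
  then have "real (2 * Suc N) \<le> real j" by (simp only: of_nat_le_iff)
  then have "2 * real (Suc N) \<le> real j" "2 * real N + 2 \<le> real j" by simp_all
  note N = this N2
  have "real j + 1 \<le> real p" "real p + 4 \<le> real n" using assms by linarith+
  with N(1,2) have nz: "Y - 1 \<noteq> 0" "Y - 2 \<noteq> 0" "X + 2 \<noteq> 0" "X + 3 \<noteq> 0" "X - Y - 1 \<noteq> 0"
    "X + A (Suc N) + 1 \<noteq> 0" "X + A (Suc N) - 1 \<noteq> 0" "X + A N + 1 \<noteq> 0"
    unfolding X_def Y_def A_def by linarith+
  let ?up = "\<lambda>m. cert_const X Y * ((X + Y + A m + 1) * (X + Y + A m) * A m * (A m - 1)) / ((X + A m + 1) * (X + A m - 1))"
  let ?lo = "cert_const X Y * ((real j - A (Suc N)) * (X + Y + real j + A (Suc N) + 3) * (2 - Y - A (Suc N))) / (X + A (Suc N) + 1)"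
  define k where "k = n - 2 * Suc N"
  have k: "real k = real n - 2 * real N - 2" "n - 2 * N = k + 2" "n - 2 * Suc N = k" "real (n - j) = real n - real j"
    using assms N2 by (auto simp: k_def)
  have shift: "w N * ((X + Y + A N + 1) * (X + Y + A N) * A N * (A N - 1))
    = w (Suc N) * ((real j - A (Suc N)) * (X + Y + real j + A (Suc N) + 3) * (2 - Y - A (Suc N)) * (X + A N + 1))"
    using summand_shift[OF assms(1), of n k "n - j"]
    unfolding w_def k(2,3,4) k(1) X_def Y_def A_def by (simp add: algebra_simps)
  have A_Suc: "X + A (Suc N) + 1 = X + A N - 1" by (simp add: A_def)
  have "w N * ?up N = w (Suc N) * ?lo"
  proof -
    have "w N * ?up N = cert_const X Y * (w N * ((X + Y + A N + 1) * (X + Y + A N) * A N * (A N - 1)))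
        / ((X + A N + 1) * (X + A N - 1))"
      by simp
    also have "\<dots> = w (Suc N) * ?lo"
      unfolding shift A_Suc using nz(8) by simp
    finally show ?thesis .
  qed
  then show ?case
    unfolding sum.atMost_Suc Suc.IH[OF Suc_leD[OF Suc.prems]] certificate[OF nz(1-7)] right_diff_distrib by simp
qed

section \<open>The coefficients of the recurrence\<close>

lemma k1_eq:
  assumes "j + 2 < i" "i < n"
  shows "k1 n i j = sqrt (2 * (real n - real i) + 5) / sqrt (2 * (real n - real i) + 1)
    * k1_rat (2 * real n - real i - real j) (real i - real j) (real j)"
proof -
  define a where "a = (real j - real i + 1) / 2"
  define b where "b = - real n + (real i + real j) / 2"
  define X where "X = 2 * real n - real i - real j"
  define Y where "Y = real i - real j"
  have nz: "Y - 2 \<noteq> 0" "Y - 1 \<noteq> 0" "X + 1 \<noteq> 0" "X + 2 \<noteq> 0" "X + 3 \<noteq> 0" "X - Y - 1 \<noteq> 0"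
    using assms unfolding X_def Y_def by linarith+
  have ab: "a = - (Y - 1) / 2" "b = - X / 2"
    by (simp_all add: a_def b_def X_def Y_def field_simps)
  have cd: "(- real j / 2) * (real n + (3 - real j) / 2) = - (real j * (X + Y + real j + 3)) / 4"
    by (simp add: X_def Y_def field_simps)
  have factors: "a - b = (X - Y + 1) / 2" "a - b - 1 = (X - Y - 1) / 2" "1 + a - b = (X - Y + 3) / 2"
    "1 - a = (Y + 1) / 2" "1 / 2 - a = Y / 2" "3 / 2 - a = (Y + 2) / 2"
    "1 - b = (X + 2) / 2" "1 / 2 - b = (X + 1) / 2" "3 / 2 - b = (X + 3) / 2"
    by (simp_all add: ab field_simps)
  have h: "- 2 * real n + real i + real j - 1 = - (X + 1)" "real i - real j - 2 = Y - 2"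
    by (simp_all add: X_def Y_def)
  have rat: "s * - (X + 1) / (t * (Y - 2))
      * ((- (J * U) / 4 * (V / 2) - - X / 2 * ((Y + 1) / 2) * (Y / 2) * ((Y + 2) / 2) / (R / 2))
        * ((W / 2) / (- (Y - 1) / 2 * ((X + 2) / 2) * ((X + 1) / 2) * ((X + 3) / 2))) - 1)
    = s / t * ((X + 1) / (Y - 2) + (X * Y * (Y + 1) * (Y + 2) / R - J * U * V) * W / ((Y - 2) * (Y - 1) * (X + 2) * (X + 3)))"
    if "R \<noteq> 0" for J R U V W s t :: real
  proof -
    have "- (J * U) / 4 * (V / 2) - - X / 2 * ((Y + 1) / 2) * (Y / 2) * ((Y + 2) / 2) / (R / 2)
      = (X * Y * (Y + 1) * (Y + 2) / R - J * U * V) / 8"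
      using that by (simp add: field_simps)
    moreover have "(W / 2) / (- (Y - 1) / 2 * ((X + 2) / 2) * ((X + 1) / 2) * ((X + 3) / 2))
      = - (8 * W) / ((Y - 1) * (X + 2) * (X + 1) * (X + 3))"
      using nz by (simp add: divide_simps) (simp add: algebra_simps)
    moreover have "s * - (X + 1) / (t * (Y - 2)) * (F / 8 * (- (8 * W) / ((Y - 1) * (X + 2) * (X + 1) * (X + 3))) - 1)
      = s / t * ((X + 1) / (Y - 2) + F * W / ((Y - 2) * (Y - 1) * (X + 2) * (X + 3)))" for F
    proof (cases "t = 0")
      case False
      with nz show ?thesis by (simp add: divide_simps) (simp add: algebra_simps)
    qed simp
    ultimately show ?thesis by (simp only:)
  qed
  show ?thesis
    unfolding k1_def Let_def a_def[symmetric] b_def[symmetric] X_def[symmetric] Y_def[symmetric] cd factors(2-9) h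
    (* The difference a - b is a subterm of a - b - 1, so its equation comes second. *)
    unfolding factors(1)
    unfolding ab k1_rat_def by (rule rat[OF nz(6)])
qed

lemma k2_eq:
  assumes "j + 2 < i" "i < n"
  shows "k2 n i j = sqrt (2 * (real n - real i) + 5) / sqrt (2 * (real n - real i) - 3)
    * k2_rat (2 * real n - real i - real j) (real i - real j)"
proof -
  define a where "a = (real j - real i + 1) / 2"
  define b where "b = - real n + (real i + real j) / 2"
  define X where "X = 2 * real n - real i - real j"
  define Y where "Y = real i - real j"
  have nz: "Y \<noteq> 0" "Y - 2 \<noteq> 0" "Y - 1 \<noteq> 0" "X + 1 \<noteq> 0" "X + 2 \<noteq> 0" "X + 3 \<noteq> 0" "X - Y - 1 \<noteq> 0"
    using assms unfolding X_def Y_def by linarith+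
  have ab: "a = - (Y - 1) / 2" "b = - X / 2"
    by (simp_all add: a_def b_def X_def Y_def field_simps)
  have factors: "a - b - 1 = (X - Y - 1) / 2" "1 + a - b = (X - Y + 3) / 2"
    "1 - a = (Y + 1) / 2" "1 / 2 - a = Y / 2" "3 / 2 - a = (Y + 2) / 2"
    "1 - b = (X + 2) / 2" "1 / 2 - b = (X + 1) / 2" "3 / 2 - b = (X + 3) / 2"
    by (simp_all add: ab field_simps)
  have rat: "s * (X - 1) * (X + 1) / (t * Y * (Y - 2))
      * (- X / 2 * ((Y + 1) / 2) * (Y / 2) * ((Y + 2) / 2) * (W / 2)
        / (R / 2 * (- (Y - 1) / 2) * ((X + 2) / 2) * ((X + 1) / 2) * ((X + 3) / 2)))
    = s / t * ((X - 1) * X * (Y + 1) * (Y + 2) * W / ((Y - 2) * (Y - 1) * (X + 2) * (X + 3) * R))"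
    if "R \<noteq> 0" for R W s t :: real
  proof (cases "t = 0")
    case False
    with nz that show ?thesis by (simp add: divide_simps) (simp add: algebra_simps)
  qed simp
  show ?thesis
    unfolding k2_def Let_def a_def[symmetric] b_def[symmetric] X_def[symmetric] Y_def[symmetric] factors
    unfolding ab k2_rat_def by (rule rat[OF nz(7)])
qed

section \<open>The recurrence\<close>

theorem theorem19:
  fixes n i j :: nat
  assumes "odd i" and "j + 2 < i" and "i + 2 \<le> n"
  shows "D1 n $$ (n - i + 2, n - j) + k1 n i j * D1 n $$ (n - i, n - j)
         + k2 n i j * D1 n $$ (n - i - 2, n - j) = 0"
proof -
  define p where "p = i - 2"
  have i: "i = p + 2" and p: "odd p" "j < p" "p + 4 \<le> n"
    using assms by (auto simp: p_def)
  define X where "X = 2 * real n - real p - 2 - real j"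
  define Y where "Y = real p + 2 - real j"
  define A where "A m = real j - 2 * real m" for m
  define w where "w q m = d_coeff q n (n - 2 * m) * moment_ratio (n - j) (n - 2 * m)" for q m
  define ra where "ra m = (2 - Y - A m) / (X + A m + 1)" for m
  define rb where "rb m = (- Y - A m) / (X + A m - 1)" for m
  obtain c where c: "\<And>q. odd q \<Longrightarrow> q \<le> n \<Longrightarrow>
      D1 n $$ (n - q, n - j) = c * (\<Sum>k\<le>n. d_coeff q n k * moment_ratio (n - j) k)"
    using D1_entry[of "n - j"] by (metis diff_le_self)
  have entry: "D1 n $$ (n - q, n - j) = c * (\<Sum>m\<le>j div 2. w q m)" if "odd q" "j < q" "q \<le> n" for q
    using c sum_even_offsets[OF that] that by (simp add: w_def)
  let ?S = "\<lambda>x. sqrt (2 * (real n - real p) + x)"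
  have pos: "?S 1 > 0" "?S (-3) > 0" "?S (-7) > 0" using p by auto
  have XY: "X = 2 * real n - real i - real j" "Y = real i - real j"
    and roots: "2 * (real n - real i) + 5 = 2 * (real n - real p) + 1"
      "2 * (real n - real i) + 1 = 2 * (real n - real p) + - 3"
      "2 * (real n - real i) - 3 = 2 * (real n - real p) + - 7"
    by (simp_all add: i X_def Y_def)
  have k1: "k1 n i j = ?S 1 / ?S (-3) * k1_rat X Y (real j)"
    and k2: "k2 n i j = ?S 1 / ?S (-7) * k2_rat X Y"
    using k1_eq[of j i n] k2_eq[of j i n] assms unfolding XY roots by auto
  have w1: "w (p + 2) m = ?S (-3) / ?S 1 * ra m * w p m"
    and w2: "w (p + 4) m = ?S (-7) / ?S 1 * (ra m * rb m) * w p m" if "m \<le> j div 2" for m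
  proof -
    have m: "2 * m \<le> n" "p + 2 + 1 < n + (n - 2 * m)" using that p by linarith+
    have "d_coeff (p + 2) n (n - 2 * m) = ?S (-3) / ?S 1 * ra m * d_coeff p n (n - 2 * m)"
      using d_coeff_shift_order[of p n "n - 2 * m"] p m
      by (simp add: ra_def X_def Y_def A_def of_nat_diff algebra_simps)
    moreover have "d_coeff (p + 4) n (n - 2 * m) = ?S (-7) / ?S (-3) * rb m * d_coeff (p + 2) n (n - 2 * m)"
      using d_coeff_shift_order[of "p + 2" n "n - 2 * m", unfolded add.assoc[of p 2 2]] p m
      by (simp add: rb_def X_def Y_def A_def of_nat_diff algebra_simps)
    ultimately show "w (p + 2) m = ?S (-3) / ?S 1 * ra m * w p m"
      "w (p + 4) m = ?S (-7) / ?S 1 * (ra m * rb m) * w p m"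
      using pos by (simp_all add: w_def)
  qed
  have "D1 n $$ (n - i + 2, n - j) + k1 n i j * D1 n $$ (n - i, n - j) + k2 n i j * D1 n $$ (n - i - 2, n - j)
    = c * (\<Sum>m\<le>j div 2. w p m + k1 n i j * w (p + 2) m + k2 n i j * w (p + 4) m)"
  proof -
    have idx: "n - i + 2 = n - p" "n - i = n - (p + 2)" "n - (p + 2) - 2 = n - (p + 4)"
      using p by (auto simp: i)
    have "D1 n $$ (n - i + 2, n - j) = c * (\<Sum>m\<le>j div 2. w p m)"
      "D1 n $$ (n - i, n - j) = c * (\<Sum>m\<le>j div 2. w (p + 2) m)"
      "D1 n $$ (n - i - 2, n - j) = c * (\<Sum>m\<le>j div 2. w (p + 4) m)"
      using p entry[of p] entry[of "p + 2"] entry[of "p + 4"] unfolding idx(1) unfolding idx by auto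
    then show ?thesis
      by (simp add: sum.distrib sum_distrib_left algebra_simps)
  qed
  also have "(\<Sum>m\<le>j div 2. w p m + k1 n i j * w (p + 2) m + k2 n i j * w (p + 4) m)
    = (\<Sum>m\<le>j div 2. w p m * (1 + k1_rat X Y (real j) * ra m + k2_rat X Y * (ra m * rb m)))"
  proof (rule sum.cong[OF refl])
    fix m assume "m \<in> {..j div 2}"
    then have m: "m \<le> j div 2" by simp
    show "w p m + k1 n i j * w (p + 2) m + k2 n i j * w (p + 4) m
      = w p m * (1 + k1_rat X Y (real j) * ra m + k2_rat X Y * (ra m * rb m))"
      unfolding k1 k2 w1[OF m] w2[OF m] using pos by (simp add: algebra_simps)
  qed
  also have "\<dots> = 0"
  proof -
    (* The upper boundary term at the last index contains the factor A (A - 1). *)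
    have "A (j div 2) = 0 \<or> A (j div 2) - 1 = 0"
      unfolding A_def by (cases "even j") (auto elim!: evenE oddE)
    then show ?thesis
      using telescoping_partial_sum[OF p order_refl]
      unfolding X_def[symmetric] Y_def[symmetric] A_def[symmetric] w_def[symmetric] ra_def rb_def by auto
  qed
  finally show ?thesis by simp
qed

end
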